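(* Let $(W,S)$ be a finite Coxeter system. For all $u,v\in W$ with $u\leq v$ in Bruhat order, the Bruhat interval $[u,v]=\{z\in W: u\leq z\leq v\}$ is a Coxeter matroid (with respect to the trivial parabolic subgroup, i.e. $J=\emptyset$, identifying $W/W_\emptyset$ with $W$).
   Context: For $w\in W$, the $w$-Bruhat order is defined by $x\leq^w y$ iff $w^{-1}x\leq w^{-1}y$ (Bruhat order). For $J\subseteq S$, and left cosets $A,B\in W/W_J$, write $A\leq^w B$ if there exist $x\in A$, $y\in B$ with $x\leq^w y$. A nonempty subset $\mathcal M\subseteq W/W_J$ is a Coxeter matroid if it satisfies the Maximality Property: for every $w\in W$ there is a unique $A\in\mathcal M$ such that $B\leq^w A$ for all $B\in\mathcal M$. (By the Gelfand–Serganova theorem this is equivalent to: every edge of the polytope $\Delta_{\mathcal M}$, the convex hull of $\{v(p): vW_J\in\mathcal M\}$ for a point $p$ in the standard geometric representation space $V$ with $(p,\alpha_s)<0$ for $s\notin J$ and $(p,\alpha_s)=0$ for $s\in J$, is parallel to a root.) *)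

theory Defs
  imports "HOL-Algebra.Algebra"
begin

definition word_prod :: "('a, 'b) monoid_scheme \<Rightarrow> 'a list \<Rightarrow> 'a" where
  "word_prod G ws = foldr (\<lambda>x y. x \<otimes>\<^bsub>G\<^esub> y) ws \<one>\<^bsub>G\<^esub>"

definition alt_word :: "'a \<Rightarrow> 'a \<Rightarrow> nat \<Rightarrow> 'a list" where
  "alt_word s t n = map (\<lambda>i. if even i then s else t) [0..<n]"

text \<open>Coxeter relators (s t)^(m(s,t)) with m(s,t) the order of s t in G
  (so m(s,s) = 1, giving s s; order 0 = infinite order gives no relation).\<close>
definition coxeter_relators :: "('a, 'b) monoid_scheme \<Rightarrow> 'a set \<Rightarrow> 'a list set" where
  "coxeter_relators G S =
     {alt_word s t (2 * group.ord G (s \<otimes>\<^bsub>G\<^esub> t)) | s t. s \<in> S \<and> t \<in> S}"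

definition relator_step :: "'a list set \<Rightarrow> 'a list \<Rightarrow> 'a list \<Rightarrow> bool" where
  "relator_step R u v \<longleftrightarrow> (\<exists>a b r. r \<in> R \<and> u = a @ r @ b \<and> v = a @ b)"

text \<open>(G,S) is a Coxeter system: G is generated by the involutions S and is presented
  by the Coxeter relations, i.e. two words in S have the same product iff they are
  equivalent under the congruence generated by the relators.  (Since the generators
  are involutions, the group presentation coincides with the monoid presentation.)\<close>
definition coxeter_system :: "('a, 'b) monoid_scheme \<Rightarrow> 'a set \<Rightarrow> bool" where
  "coxeter_system G S \<longleftrightarrow>
     group G \<and> S \<subseteq> carrier G \<and> \<one>\<^bsub>G\<^esub> \<notin> S \<and>
     (\<forall>s\<in>S. s \<otimes>\<^bsub>G\<^esub> s = \<one>\<^bsub>G\<^esub>) \<and>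
     (\<forall>w\<in>carrier G. \<exists>ws\<in>lists S. word_prod G ws = w) \<and>
     (\<forall>u\<in>lists S. \<forall>v\<in>lists S.
        word_prod G u = word_prod G v \<longleftrightarrow>
        (symclp (relator_step (coxeter_relators G S)))\<^sup>*\<^sup>* u v)"

definition coxeter_length :: "('a, 'b) monoid_scheme \<Rightarrow> 'a set \<Rightarrow> 'a \<Rightarrow> nat" where
  "coxeter_length G S w = (LEAST n. \<exists>ws\<in>lists S. length ws = n \<and> word_prod G ws = w)"

definition reflections :: "('a, 'b) monoid_scheme \<Rightarrow> 'a set \<Rightarrow> 'a set" where
  "reflections G S = {g \<otimes>\<^bsub>G\<^esub> s \<otimes>\<^bsub>G\<^esub> inv\<^bsub>G\<^esub> g | g s. g \<in> carrier G \<and> s \<in> S}"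

definition bruhat_step :: "('a, 'b) monoid_scheme \<Rightarrow> 'a set \<Rightarrow> 'a \<Rightarrow> 'a \<Rightarrow> bool" where
  "bruhat_step G S x y \<longleftrightarrow> x \<in> carrier G \<and>
     (\<exists>t\<in>reflections G S. y = x \<otimes>\<^bsub>G\<^esub> t) \<and>
     coxeter_length G S x < coxeter_length G S y"

definition bruhat_le :: "('a, 'b) monoid_scheme \<Rightarrow> 'a set \<Rightarrow> 'a \<Rightarrow> 'a \<Rightarrow> bool" where
  "bruhat_le G S x y \<longleftrightarrow> x \<in> carrier G \<and> y \<in> carrier G \<and> (bruhat_step G S)\<^sup>*\<^sup>* x y"

definition wbruhat_le :: "('a, 'b) monoid_scheme \<Rightarrow> 'a set \<Rightarrow> 'a \<Rightarrow> 'a \<Rightarrow> 'a \<Rightarrow> bool" where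
  "wbruhat_le G S w x y \<longleftrightarrow>
     bruhat_le G S (inv\<^bsub>G\<^esub> w \<otimes>\<^bsub>G\<^esub> x) (inv\<^bsub>G\<^esub> w \<otimes>\<^bsub>G\<^esub> y)"

definition parabolic :: "('a, 'b) monoid_scheme \<Rightarrow> 'a set \<Rightarrow> 'a set" where
  "parabolic G J = generate G J"

definition coset_wbruhat_le ::
  "('a, 'b) monoid_scheme \<Rightarrow> 'a set \<Rightarrow> 'a \<Rightarrow> 'a set \<Rightarrow> 'a set \<Rightarrow> bool" where
  "coset_wbruhat_le G S w A B \<longleftrightarrow> (\<exists>x\<in>A. \<exists>y\<in>B. wbruhat_le G S w x y)"

definition coxeter_matroid ::
  "('a, 'b) monoid_scheme \<Rightarrow> 'a set \<Rightarrow> 'a set \<Rightarrow> 'a set set \<Rightarrow> bool" where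
  "coxeter_matroid G S J M \<longleftrightarrow>
     M \<noteq> {} \<and> M \<subseteq> (\<lambda>x. x <#\<^bsub>G\<^esub> parabolic G J) ` carrier G \<and>
     (\<forall>w\<in>carrier G. \<exists>!A. A \<in> M \<and> (\<forall>B\<in>M. coset_wbruhat_le G S w B A))"

end

(* For x = w^-1 one has to show that x [u,v] has a greatest element.  Call z in [u,v] a sink if no
   reflection t satisfies tz in [u,v] and xz < xtz.  Every z climbs to a sink, so it suffices that
   the sink is unique.  Label an edge z -> tz of the Bruhat graph by the left reflection t, and choose
   a reflection order in which the labels t with xz < xtz on upward edges precede all others.
   If z is a sink, the increasing saturated chain from u to z only has labels of the first kind and
   the one from z to v only labels of the second kind, so that they concatenate to an increasing
   saturated chain from u to v through z at which the kind of label changes.  Since [u,v] has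
   exactly one increasing saturated chain (Dyer), z is determined.  Uniqueness of the chain is
   obtained from the recursion for the R-polynomials, i.e. from the Hecke algebra. *)

theory Submission
  imports Defs "HOL-Computational_Algebra.Polynomial"
begin

declare in_lists_conv_set [iff del]

section \<open>Sums and alternating words\<close>

lemma sum_lessThan_add:
  fixes f :: "nat \<Rightarrow> nat"
  shows "sum f {..<m + k} = sum f {..<m} + (\<Sum>i<k. f (m + i))"
  by (induction k) auto

lemma pCons_0_sum:
  fixes f :: "'a \<Rightarrow> 'b::comm_monoid_add poly"
  shows "pCons 0 (sum f A) = (\<Sum>x\<in>A. pCons 0 (f x))"
proof -
  have "pCons 0 (p + q) = pCons 0 p + pCons 0 q" for p q :: "'b poly"
    by simp
  then show ?thesis
    by (induction A rule: infinite_finite_induct) (simp_all del: add_pCons)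
qed

lemma alt_word_Suc: "alt_word s t (Suc n) = s # alt_word t s n"
  by (simp add: alt_word_def map_upt_Suc del: upt_Suc)

lemma alt_word_0: "alt_word s t 0 = []"
  by (simp add: alt_word_def)

lemma alt_word_in_lists: "s \<in> S \<Longrightarrow> t \<in> S \<Longrightarrow> alt_word s t n \<in> lists S"
  by (induction n arbitrary: s t) (auto simp: alt_word_Suc alt_word_0)

section \<open>Words in a Coxeter group\<close>

locale coxeter = group G for G (structure) +
  fixes S :: "'a set"
  assumes coxeter: "coxeter_system G S"
begin

abbreviation "wp \<equiv> word_prod G"
abbreviation "len \<equiv> coxeter_length G S"
abbreviation "R \<equiv> reflections G S"
abbreviation "ble \<equiv> bruhat_le G S"

lemma S_carrier [simp]: "s \<in> S \<Longrightarrow> s \<in> carrier G"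
  using coxeter by (auto simp: coxeter_system_def)

lemma S_square [simp]: "s \<in> S \<Longrightarrow> s \<otimes> s = \<one>"
  using coxeter by (auto simp: coxeter_system_def)

lemma S_inv [simp]: "s \<in> S \<Longrightarrow> inv s = s"
  by (simp add: inv_equality)

lemma cancel_inv_left [simp]: "a \<in> carrier G \<Longrightarrow> b \<in> carrier G \<Longrightarrow> inv a \<otimes> (a \<otimes> b) = b"
  by (simp flip: m_assoc)

lemma cancel_left_inv [simp]: "a \<in> carrier G \<Longrightarrow> b \<in> carrier G \<Longrightarrow> a \<otimes> (inv a \<otimes> b) = b"
  by (simp flip: m_assoc)

lemma cancel_S [simp]: "s \<in> S \<Longrightarrow> b \<in> carrier G \<Longrightarrow> s \<otimes> (s \<otimes> b) = b"
  by (simp flip: m_assoc)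

lemmas group_norm = m_assoc inv_mult_group

lemma wp_Nil [simp]: "wp [] = \<one>"
  by (simp add: word_prod_def)

lemma wp_Cons [simp]: "wp (s # ws) = s \<otimes> wp ws"
  by (simp add: word_prod_def)

lemma wp_carrier [simp]: "ws \<in> lists S \<Longrightarrow> wp ws \<in> carrier G"
  by (induction ws) auto

lemma wp_append: "a \<in> lists S \<Longrightarrow> b \<in> lists S \<Longrightarrow> wp (a @ b) = wp a \<otimes> wp b"
  by (induction a) (auto simp: m_assoc)

lemma ex_word: "w \<in> carrier G \<Longrightarrow> \<exists>ws\<in>lists S. wp ws = w"
  using coxeter by (auto simp: coxeter_system_def)

section \<open>The parity cocycle of a word\<close>

text \<open>\<open>inv_parity ws t\<close> is the parity of the number of occurrences of \<open>t\<close> among the elements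
  \<open>s\<^sub>1 \<dots> s\<^sub>i \<dots> s\<^sub>1\<close> attached to the word \<open>ws = s\<^sub>1 \<dots> s\<^sub>k\<close>.\<close>

primrec inv_parity :: "'a list \<Rightarrow> 'a \<Rightarrow> bool" where
  "inv_parity [] t = False"
| "inv_parity (s # ws) t = ((t = s) \<noteq> inv_parity ws (s \<otimes> t \<otimes> s))"

lemma inv_parity_append:
  assumes "a \<in> lists S" "b \<in> lists S" "t \<in> carrier G"
  shows "inv_parity (a @ b) t = (inv_parity a t \<noteq> inv_parity b (inv (wp a) \<otimes> t \<otimes> wp a))"
  using assms
proof (induction a arbitrary: t)
  case (Cons s a)
  then show ?case by (auto simp: group_norm)
qed auto

text \<open>Counting positions from 0, the element attached to the letter at position
  \<open>i\<close> of the word s t s ... is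
  \<open>(s \<otimes> t) [^] i \<otimes> s\<close>.\<close>

lemma inv_parity_alt_word:
  assumes "s \<in> S" "t \<in> S" "r \<in> carrier G"
  shows "inv_parity (alt_word s t n) r \<longleftrightarrow>
    odd (\<Sum>i<n. if r = (s \<otimes> t) [^] i \<otimes> s then 1 else 0 :: nat)"
  using assms
proof (induction n arbitrary: s t r)
  case (Suc n)
  \<comment> \<open>Dropping the first letter swaps \<open>s\<close> and \<open>t\<close> and
    conjugates \<open>r\<close> by \<open>s\<close>, which shifts the index \<open>i\<close> by
    one.\<close>
  have "(s \<otimes> r \<otimes> s = (t \<otimes> s) [^] i \<otimes> t) = (r = (s \<otimes> t) [^] Suc i \<otimes> s)" for i
  proof -
    have *: "s \<otimes> ((t \<otimes> s) [^] i \<otimes> t) \<otimes> s = (s \<otimes> t) [^] Suc i \<otimes> s"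
    proof (induction i)
      case (Suc i)
      have "(t \<otimes> s) [^] Suc i = (t \<otimes> s) \<otimes> (t \<otimes> s) [^] i"
        using Suc.prems \<open>s \<in> S\<close> \<open>t \<in> S\<close> nat_pow_Suc2[of "t \<otimes> s" i] by simp
      then have "s \<otimes> ((t \<otimes> s) [^] Suc i \<otimes> t) \<otimes> s =
          (s \<otimes> t) \<otimes> (s \<otimes> ((t \<otimes> s) [^] i \<otimes> t) \<otimes> s)"
        using \<open>s \<in> S\<close> \<open>t \<in> S\<close> by (simp add: m_assoc del: nat_pow_Suc)
      also have "\<dots> = (s \<otimes> t) \<otimes> (s \<otimes> t) [^] Suc i \<otimes> s"
        using \<open>s \<in> S\<close> \<open>t \<in> S\<close> Suc.IH by (simp add: m_assoc del: nat_pow_Suc)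
      also have "(s \<otimes> t) \<otimes> (s \<otimes> t) [^] Suc i = (s \<otimes> t) [^] Suc (Suc i)"
        using \<open>s \<in> S\<close> \<open>t \<in> S\<close> nat_pow_Suc2[of "s \<otimes> t" "Suc i"] by simp
      finally show ?case .
    qed (use Suc.prems in \<open>simp add: m_assoc\<close>)
    have "s \<otimes> r \<otimes> s = c \<longleftrightarrow> r = s \<otimes> c \<otimes> s" if "c \<in> carrier G" for c
      using that Suc.prems by (auto simp: m_assoc)
    with * show ?thesis
      using Suc.prems by (metis S_carrier m_closed nat_pow_closed)
  qed
  then show ?case
    using Suc.prems Suc.IH[of t s "s \<otimes> r \<otimes> s"]
    by (auto simp: alt_word_Suc sum.lessThan_Suc_shift simp del: nat_pow_Suc sum.lessThan_Suc)
qed (simp add: alt_word_0)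

text \<open>With \<open>m = ord (a \<otimes> b)\<close> the attached elements repeat with period
  \<open>m\<close>, so each is met an even number of times along the \<open>2 * m\<close>
  letters.\<close>

lemma inv_parity_relator:
  assumes "r \<in> coxeter_relators G S" "t \<in> carrier G"
  shows "\<not> inv_parity r t"
proof -
  obtain a b where ab: "a \<in> S" "b \<in> S" "r = alt_word a b (2 * ord (a \<otimes> b))"
    using assms(1) by (auto simp: coxeter_relators_def)
  define m where "m = ord (a \<otimes> b)"
  have "(a \<otimes> b) [^] (m + i) = (a \<otimes> b) [^] i" for i
    using ab by (simp add: m_def pow_ord_eq_1 flip: nat_pow_mult)
  then show ?thesis
    using inv_parity_alt_word[OF ab(1,2) assms(2), of "m + m"] ab(3)
    by (simp add: sum_lessThan_add m_def mult_2)
qed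

lemma relator_in_lists: "r \<in> coxeter_relators G S \<Longrightarrow> r \<in> lists S"
  using alt_word_in_lists by (fastforce simp: coxeter_relators_def)

lemma wp_eq_iff:
  "u \<in> lists S \<Longrightarrow> v \<in> lists S \<Longrightarrow>
    wp u = wp v \<longleftrightarrow> (symclp (relator_step (coxeter_relators G S)))\<^sup>*\<^sup>* u v"
  using coxeter by (auto simp: coxeter_system_def)

lemma wp_relator:
  assumes "r \<in> coxeter_relators G S"
  shows "wp r = \<one>"
proof -
  have "relator_step (coxeter_relators G S) r []"
    unfolding relator_step_def using assms by force
  then have "(symclp (relator_step (coxeter_relators G S)))\<^sup>*\<^sup>* r []"
    by (auto simp: symclp_def)
  then show ?thesis
    using wp_eq_iff[OF relator_in_lists[OF assms], of "[]"] by simp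
qed

text \<open>A relator has trivial product, so the word after it sees the same conjugate of
  \<open>t\<close>. The disjunctive premise makes the lemma fit both directions of
  \<open>symclp\<close>.\<close>

lemma relator_step_par:
  assumes "relator_step (coxeter_relators G S) u v" "t \<in> carrier G" "u \<in> lists S \<or> v \<in> lists S"
  shows "u \<in> lists S \<and> v \<in> lists S \<and> inv_parity u t = inv_parity v t"
proof -
  obtain a b r where r: "r \<in> coxeter_relators G S" "u = a @ r @ b" "v = a @ b"
    using assms(1) by (auto simp: relator_step_def)
  have l: "r \<in> lists S" "a \<in> lists S" "b \<in> lists S"
    using relator_in_lists[OF r(1)] assms(3) r(2,3) by auto
  then show ?thesis
    using r assms(2) by (auto simp: inv_parity_append inv_parity_relator wp_relator)
qed

text \<open>The presentation turns equality of products into a chain of relator insertions and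
  deletions, none of which changes the parity.\<close>

lemma inv_parity_cong:
  assumes "u \<in> lists S" "v \<in> lists S" "wp u = wp v" "t \<in> carrier G"
  shows "inv_parity u t = inv_parity v t"
proof -
  have "(symclp (relator_step (coxeter_relators G S)))\<^sup>*\<^sup>* u v"
    using assms wp_eq_iff by blast
  then have "v \<in> lists S \<and> inv_parity u t = inv_parity v t"
    by (induction rule: rtranclp_induct)
      (use assms(1,4) relator_step_par in \<open>auto simp only: symclp_def\<close>)
  then show ?thesis ..
qed

text \<open>On the carrier the choice of the word is immaterial by \<open>inv_parity_cong\<close>.
  For a reflection \<open>t\<close> this says that \<open>t\<close> is a left inversion of
  \<open>w\<close>, see \<open>len_less_iff_N\<close>.\<close>

definition N :: "'a \<Rightarrow> 'a \<Rightarrow> bool" where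
  "N w = inv_parity (SOME ws. ws \<in> lists S \<and> wp ws = w)"

lemma N_wp:
  assumes "ws \<in> lists S" "t \<in> carrier G"
  shows "N (wp ws) t = inv_parity ws t"
proof -
  have "(SOME vs. vs \<in> lists S \<and> wp vs = wp ws) \<in> lists S \<and>
      wp (SOME vs. vs \<in> lists S \<and> wp vs = wp ws) = wp ws"
    by (rule someI_ex) (use assms in blast)
  then show ?thesis
    unfolding N_def using inv_parity_cong assms by blast
qed

lemma N_mult:
  assumes "w \<in> carrier G" "y \<in> carrier G" "t \<in> carrier G"
  shows "N (w \<otimes> y) t = (N w t \<noteq> N y (inv w \<otimes> t \<otimes> w))"
proof -
  obtain a b where "a \<in> lists S" "wp a = w" "b \<in> lists S" "wp b = y"
    using ex_word assms by metis
  then show ?thesis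
    using N_wp[of "a @ b" t] N_wp[of a t] N_wp[of b] inv_parity_append[of a b t] assms
    by (auto simp: wp_append)
qed

lemma N_one [simp]: "t \<in> carrier G \<Longrightarrow> \<not> N \<one> t"
  using N_wp[of "[]" t] by simp

lemma N_S: "s \<in> S \<Longrightarrow> t \<in> carrier G \<Longrightarrow> N s t = (t = s)"
  using N_wp[of "[s]" t] by simp

lemma N_inv:
  assumes "w \<in> carrier G" "t \<in> carrier G"
  shows "N (inv w) t = N w (w \<otimes> t \<otimes> inv w)"
  using N_mult[of "inv w" w t] assms by simp

section \<open>Reflections\<close>

lemma R_E:
  assumes "t \<in> R"
  obtains g s where "g \<in> carrier G" "s \<in> S" "t = g \<otimes> s \<otimes> inv g"
  using assms by (auto simp: reflections_def)

lemma R_carrier [simp]: "t \<in> R \<Longrightarrow> t \<in> carrier G"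
  by (auto elim: R_E)

lemma R_square [simp]: "t \<in> R \<Longrightarrow> t \<otimes> t = \<one>"
  by (auto elim!: R_E simp: m_assoc)

lemma R_inv [simp]: "t \<in> R \<Longrightarrow> inv t = t"
  by (simp add: inv_equality)

lemma cancel_R [simp]: "t \<in> R \<Longrightarrow> b \<in> carrier G \<Longrightarrow> t \<otimes> (t \<otimes> b) = b"
  by (simp flip: m_assoc)

lemma S_R [simp]: "s \<in> S \<Longrightarrow> s \<in> R"
  unfolding reflections_def by (force intro: exI[of _ \<one>])

lemma R_conj [simp]:
  assumes "t \<in> R" "g \<in> carrier G"
  shows "g \<otimes> t \<otimes> inv g \<in> R"
proof -
  obtain h s where h: "h \<in> carrier G" "s \<in> S" "t = h \<otimes> s \<otimes> inv h"
    using assms(1) by (rule R_E)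
  then have "g \<otimes> t \<otimes> inv g = (g \<otimes> h) \<otimes> s \<otimes> inv (g \<otimes> h)"
    using assms(2) by (simp add: group_norm)
  then show ?thesis
    unfolding reflections_def using h assms(2) by blast
qed

lemma R_conj' [simp]: "t \<in> R \<Longrightarrow> g \<in> carrier G \<Longrightarrow> inv g \<otimes> t \<otimes> g \<in> R"
  using R_conj[of t "inv g"] by simp

text \<open>Expanding \<open>t = g \<otimes> s \<otimes> inv g\<close> by the cocycle rule
  \<open>N_mult\<close>, the contributions of \<open>g\<close> and \<open>inv g\<close> agree and
  cancel, leaving \<open>N s s\<close>.\<close>

lemma N_refl_self:
  assumes "t \<in> R"
  shows "N t t"
proof -
  obtain g s where g: "g \<in> carrier G" "s \<in> S" "t = g \<otimes> s \<otimes> inv g"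
    using assms by (rule R_E)
  have "N t t = (N g t \<noteq> (N s s \<noteq> N (inv g) s))"
    using g N_mult[of "g \<otimes> s" "inv g" t] N_mult[of g s t] by (auto simp: group_norm)
  moreover have "N (inv g) s = N g t"
    using N_inv[of g s] g by simp
  ultimately show ?thesis
    using N_S[of s s] g by auto
qed

lemma N_refl_mult: "t \<in> R \<Longrightarrow> w \<in> carrier G \<Longrightarrow> N (t \<otimes> w) t = (\<not> N w t)"
  using N_mult[of t w t] N_refl_self[of t] by (simp add: m_assoc)

section \<open>Strong exchange, length and descents\<close>

text \<open>Strong exchange: an odd count means that \<open>t\<close> is attached to some letter,
  and left multiplication by \<open>t\<close> deletes that letter.\<close>

lemma inv_parity_deletion:
  assumes "ws \<in> lists S" "t \<in> carrier G" "inv_parity ws t"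
  shows "\<exists>vs\<in>lists S. length vs < length ws \<and> wp vs = t \<otimes> wp ws"
  using assms
proof (induction ws arbitrary: t)
  case (Cons s ws)
  show ?case
  proof (cases "t = s")
    case True
    then show ?thesis
      by (intro bexI[of _ ws]) (use Cons.hyps True in auto)
  next
    case False
    then obtain vs where "vs \<in> lists S" "length vs < length ws" "wp vs = s \<otimes> t \<otimes> s \<otimes> wp ws"
      using Cons.IH[of "s \<otimes> t \<otimes> s"] Cons.hyps Cons.prems by auto
    then show ?thesis
      by (intro bexI[of _ "s # vs"]) (use Cons.hyps Cons.prems in \<open>auto simp: m_assoc\<close>)
  qed
qed simp

lemma len_le: "ws \<in> lists S \<Longrightarrow> len (wp ws) \<le> length ws"
  unfolding coxeter_length_def by (rule Least_le) auto

lemma reduced_word: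
  assumes "w \<in> carrier G"
  shows "\<exists>ws\<in>lists S. length ws = len w \<and> wp ws = w"
  unfolding coxeter_length_def
  by (rule LeastI_ex) (use ex_word[OF assms] in auto)

lemma N_len_less:
  assumes "N w t" "t \<in> carrier G" "w \<in> carrier G"
  shows "len (t \<otimes> w) < len w"
proof -
  obtain ws where ws: "ws \<in> lists S" "length ws = len w" "wp ws = w"
    using reduced_word assms(3) by blast
  then obtain vs where "vs \<in> lists S" "length vs < length ws" "wp vs = t \<otimes> w"
    using inv_parity_deletion[of ws t] assms N_wp by auto
  then show ?thesis
    using ws len_le by fastforce
qed

text \<open>If \<open>t\<close> is not an inversion of \<open>w\<close>, then it is one of
  \<open>t \<otimes> w\<close> by \<open>N_refl_mult\<close>, and exchange applied there gives the
  opposite inequality.\<close>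

lemma len_less_iff_N:
  assumes "t \<in> R" "w \<in> carrier G"
  shows "len (t \<otimes> w) < len w \<longleftrightarrow> N w t"
    and "len w < len (t \<otimes> w) \<longleftrightarrow> \<not> N w t"
proof -
  have "len w < len (t \<otimes> w)" if "\<not> N w t"
    using N_len_less[of "t \<otimes> w" t] N_refl_mult[of t w] assms that by auto
  then show "len (t \<otimes> w) < len w \<longleftrightarrow> N w t" "len w < len (t \<otimes> w) \<longleftrightarrow> \<not> N w t"
    using N_len_less[of w t] assms by fastforce+
qed

text \<open>Right multiplication by \<open>s\<close> is left multiplication by the reflection
  \<open>w \<otimes> s \<otimes> inv w\<close>, so this makes \<open>s\<close> a right descent of
  \<open>w\<close>.\<close>

definition rdesc :: "'a \<Rightarrow> 'a \<Rightarrow> bool" where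
  "rdesc w s = N w (w \<otimes> s \<otimes> inv w)"

lemma rdesc_len:
  assumes "s \<in> S" "w \<in> carrier G"
  shows "len (w \<otimes> s) < len w \<longleftrightarrow> rdesc w s" "len w < len (w \<otimes> s) \<longleftrightarrow> \<not> rdesc w s"
  using len_less_iff_N[OF R_conj[of s w], of w] assms by (simp_all add: rdesc_def m_assoc)

lemma len_mult_S:
  assumes "s \<in> S" "w \<in> carrier G"
  shows "len (w \<otimes> s) \<le> Suc (len w)"
proof -
  obtain ws where ws: "ws \<in> lists S" "length ws = len w" "wp ws = w"
    using reduced_word assms(2) by blast
  then show ?thesis
    using len_le[of "ws @ [s]"] assms by (simp add: wp_append)
qed

lemma rdesc_mult_S: "s \<in> S \<Longrightarrow> w \<in> carrier G \<Longrightarrow> rdesc (w \<otimes> s) s = (\<not> rdesc w s)"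
  using rdesc_len[of s w] rdesc_len[of s "w \<otimes> s"] by (auto simp: m_assoc)

lemma len_rdesc:
  assumes "s \<in> S" "w \<in> carrier G"
  shows "len (w \<otimes> s) = (if rdesc w s then len w - 1 else Suc (len w))"
    and "rdesc w s \<Longrightarrow> len w = Suc (len (w \<otimes> s))"
  using rdesc_len[OF assms] len_mult_S[OF assms] len_mult_S[of s "w \<otimes> s"] assms
  by (auto simp: m_assoc)

lemma ex_rdesc:
  assumes "w \<in> carrier G" "w \<noteq> \<one>"
  shows "\<exists>s\<in>S. rdesc w s"
proof -
  obtain ws where ws: "ws \<in> lists S" "length ws = len w" "wp ws = w"
    using reduced_word assms(1) by blast
  then have "ws \<noteq> []" using assms(2) by auto
  then obtain vs s where vs: "ws = vs @ [s]" using rev_exhaust by blast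
  then have "wp vs = w \<otimes> s" "vs \<in> lists S" "s \<in> S"
    using ws by (auto simp: wp_append m_assoc)
  then show ?thesis
    using rdesc_len[of s w] len_le[of vs] vs ws assms(1) by (intro bexI[of _ s]) auto
qed

lemma len_one [simp]: "len \<one> = 0"
  using len_le[of "[]"] by simp

lemma len_0_iff: "w \<in> carrier G \<Longrightarrow> len w = 0 \<longleftrightarrow> w = \<one>"
  using ex_rdesc[of w] len_rdesc(2)[of _ w] by fastforce

section \<open>Bruhat order and the lifting property\<close>

text \<open>Bruhat steps are defined by reflections on the right; conjugating by \<open>a\<close>
  gives the left label used for the chains below.\<close>

lemma bruhat_stepI:
  assumes "r \<in> R" "a \<in> carrier G" "\<not> N a r"
  shows "bruhat_step G S a (r \<otimes> a)"
proof -
  have "r \<otimes> a = a \<otimes> (inv a \<otimes> r \<otimes> a)"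
    using assms by (simp add: m_assoc)
  then show ?thesis
    unfolding bruhat_step_def using assms len_less_iff_N R_conj' by blast
qed

lemma bruhat_stepE:
  assumes "bruhat_step G S a b"
  obtains r where "a \<in> carrier G" "b \<in> carrier G" "r \<in> R" "b = r \<otimes> a" "\<not> N a r"
    "len a < len b"
proof -
  obtain t where t: "a \<in> carrier G" "t \<in> R" "b = a \<otimes> t" "len a < len b"
    using assms by (auto simp: bruhat_step_def)
  then have "b = (a \<otimes> t \<otimes> inv a) \<otimes> a"
    by (simp add: m_assoc)
  then show thesis
    using that[of "a \<otimes> t \<otimes> inv a"] t len_less_iff_N[OF R_conj[of t a], of a] by simp
qed

lemma ble_refl [simp]: "a \<in> carrier G \<Longrightarrow> ble a a"
  by (simp add: bruhat_le_def)

lemma ble_carrier: "ble a b \<Longrightarrow> a \<in> carrier G" "ble a b \<Longrightarrow> b \<in> carrier G"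
  by (simp_all add: bruhat_le_def)

lemma ble_trans: "ble a b \<Longrightarrow> ble b c \<Longrightarrow> ble a c"
  by (auto simp: bruhat_le_def)

lemma step_ble: "bruhat_step G S a b \<Longrightarrow> ble a b"
  by (auto simp: bruhat_le_def elim: bruhat_stepE)

lemma ble_induct [consumes 1, case_names refl step]:
  assumes "ble a b" "P a" "\<And>b c. ble a b \<Longrightarrow> bruhat_step G S b c \<Longrightarrow> P b \<Longrightarrow> P c"
  shows "P b"
proof -
  have "(bruhat_step G S)\<^sup>*\<^sup>* a b" "a \<in> carrier G"
    using assms(1) by (auto simp: bruhat_le_def)
  then have "ble a b \<and> P b"
  proof (induction rule: rtranclp_induct)
    case (step y z)
    then show ?case
      using assms(3) step_ble ble_trans by blast
  qed (use assms(2) in simp)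
  then show ?thesis ..
qed

lemma ble_converse_induct [consumes 1, case_names refl step]:
  assumes "ble a b" "P b" "\<And>a c. bruhat_step G S a c \<Longrightarrow> ble c b \<Longrightarrow> P c \<Longrightarrow> P a"
  shows "P a"
proof -
  have "(bruhat_step G S)\<^sup>*\<^sup>* a b" "b \<in> carrier G"
    using assms(1) by (auto simp: bruhat_le_def)
  then have "ble a b \<and> P a"
  proof (induction rule: converse_rtranclp_induct)
    case (step y z)
    then show ?case
      using assms(3) step_ble ble_trans by blast
  qed (use assms(2) in simp)
  then show ?thesis ..
qed

lemma ble_len: "ble a b \<Longrightarrow> a = b \<or> len a < len b"
  by (induction rule: ble_induct) (auto elim!: bruhat_stepE)

lemma ble_antisym: "ble a b \<Longrightarrow> ble b a \<Longrightarrow> a = b"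
  by (metis ble_len less_asym)

lemma refl_ble:
  assumes "r \<in> R" "a \<in> carrier G"
  shows "\<not> N a r \<Longrightarrow> ble a (r \<otimes> a)" "N a r \<Longrightarrow> ble (r \<otimes> a) a"
  using step_ble[OF bruhat_stepI[OF assms]]
    step_ble[OF bruhat_stepI[of r "r \<otimes> a"]] N_refl_mult[OF assms] assms by auto

lemma S_ble:
  assumes "s \<in> S" "a \<in> carrier G"
  shows "\<not> rdesc a s \<Longrightarrow> ble a (a \<otimes> s)" "rdesc a s \<Longrightarrow> ble (a \<otimes> s) a"
  using refl_ble[OF R_conj[of s a], of a] assms by (simp_all add: rdesc_def m_assoc)

text \<open>By the cocycle rule the inversions of \<open>a\<close> and \<open>a \<otimes> s\<close>
  differ only at \<open>a \<otimes> s \<otimes> inv a\<close>, and the label of the step is that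
  reflection only if \<open>b = a \<otimes> s\<close>.\<close>

lemma step_mult_S:
  assumes "bruhat_step G S a b" "s \<in> S" "b \<noteq> a \<otimes> s"
  shows "bruhat_step G S (a \<otimes> s) (b \<otimes> s)"
proof -
  obtain r where r: "a \<in> carrier G" "b \<in> carrier G" "r \<in> R" "b = r \<otimes> a" "\<not> N a r"
    using assms(1) by (rule bruhat_stepE)
  have "inv a \<otimes> r \<otimes> a \<noteq> s"
    using assms(2,3) r by (auto simp: m_assoc)
  then have "\<not> N (a \<otimes> s) r"
    using N_mult[of a s r] N_S[of s "inv a \<otimes> r \<otimes> a"] r assms(2) by auto
  then show ?thesis
    using bruhat_stepI[of r "a \<otimes> s"] r assms(2) by (simp add: m_assoc)
qed

text \<open>Descending from \<open>b\<close>, a step from \<open>a\<close> to \<open>c\<close>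
  either has \<open>c = a \<otimes> s\<close>, which is already below \<open>b\<close>, or is
  carried by \<open>s\<close> to a step from \<open>a \<otimes> s\<close> to
  \<open>c \<otimes> s\<close>.\<close>

lemma lifting_above:
  assumes "ble a b" "s \<in> S" "rdesc b s"
  shows "ble (a \<otimes> s) b"
  using assms
proof (induction rule: ble_converse_induct)
  case refl
  then show ?case using S_ble(2) ble_carrier(2)[OF assms(1)] by simp
next
  case (step a c)
  then show ?case
    using step_mult_S[of a c s] step_ble ble_trans by metis
qed

lemma lifting_below:
  assumes "ble a b" "s \<in> S" "\<not> rdesc a s"
  shows "ble a (b \<otimes> s)"
  using assms
proof (induction rule: ble_induct)
  case refl
  then show ?case using S_ble(1) ble_carrier(1)[OF assms(1)] by simp
next
  case (step b c)
  have "b = c \<otimes> s" if "c = b \<otimes> s"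
    using that step.prems step.hyps(1) ble_carrier by (simp add: m_assoc)
  then show ?case
    using step step_mult_S[of b c s] step_ble ble_trans by metis
qed

text \<open>\<open>a \<otimes> s\<close> is below \<open>b\<close> by \<open>lifting_above\<close>
  and does not have \<open>s\<close> as a descent, so \<open>lifting_below\<close> lowers the top as
  well.\<close>

lemma lifting:
  assumes "ble a b" "s \<in> S" "rdesc a s" "rdesc b s"
  shows "ble (a \<otimes> s) (b \<otimes> s)"
  using lifting_below[OF lifting_above[of a b s]] rdesc_mult_S[of s a] assms ble_carrier
  by blast

lemma step_mult_S_left:
  assumes "bruhat_step G S a b" "s \<in> S" "b \<noteq> s \<otimes> a"
  shows "bruhat_step G S (s \<otimes> a) (s \<otimes> b)"
proof -
  obtain r where r: "a \<in> carrier G" "b \<in> carrier G" "r \<in> R" "b = r \<otimes> a" "\<not> N a r"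
    using assms(1) by (rule bruhat_stepE)
  have c: "s \<otimes> r \<otimes> s \<in> R"
    using R_conj[of r s] r assms(2) by simp
  have "s \<otimes> r \<otimes> s \<noteq> s"
  proof
    assume "s \<otimes> r \<otimes> s = s"
    then have "s \<otimes> (s \<otimes> r \<otimes> s) \<otimes> s = s \<otimes> s \<otimes> s" by simp
    then show False using assms(2,3) r by (simp add: m_assoc)
  qed
  then have "\<not> N (s \<otimes> a) (s \<otimes> r \<otimes> s)"
    using N_mult[of s a "s \<otimes> r \<otimes> s"] N_S[of s "s \<otimes> r \<otimes> s"] r assms(2) by (simp add: m_assoc)
  then show ?thesis
    using bruhat_stepI[OF c, of "s \<otimes> a"] r assms(2) by (simp add: m_assoc)
qed

lemma lifting_above_left:
  assumes "ble a b" "s \<in> S" "N b s"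
  shows "ble (s \<otimes> a) b"
  using assms
proof (induction rule: ble_converse_induct)
  case refl
  then show ?case using refl_ble(2)[of s b] ble_carrier(2)[OF assms(1)] by simp
next
  case (step a c)
  then show ?case
    using step_mult_S_left[of a c s] step_ble ble_trans by metis
qed

text \<open>Such an \<open>x\<close> is the longest element: left lifting, applied letter by letter,
  puts every \<open>wp ws \<otimes> x\<close> below \<open>x\<close>, in particular
  \<open>r \<otimes> x\<close> for each reflection \<open>r\<close>.\<close>

lemma N_maximal:
  assumes x: "x \<in> carrier G" "\<And>s. s \<in> S \<Longrightarrow> N x s" and t: "t \<in> R"
  shows "N x t" "N (inv x) t"
proof -
  have le: "ble (wp ws \<otimes> x) x" if "ws \<in> lists S" for ws
    using that
  proof (induction ws)
    case (Cons s ws)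
    then show ?case
      using lifting_above_left[of "wp ws \<otimes> x" x s] x by (simp add: m_assoc)
  qed (use x in simp)
  have N: "N x r" if "r \<in> R" for r
  proof -
    have "ble (r \<otimes> x) x"
      using le ex_word[of r] that by auto
    then show ?thesis
      using ble_len[of "r \<otimes> x" x] len_less_iff_N[of r x] that x by auto
  qed
  show "N x t" by (rule N[OF t])
  show "N (inv x) t"
    using N_inv[of x t] N[OF R_conj[OF t]] x t by simp
qed

section \<open>Chains with monotone labels and the Hecke algebra\<close>

text \<open>\<open>chain_poly ts z u\<close> counts the chains from \<open>u\<close> up to \<open>z\<close> in the Bruhat graph whose successive labels
  form a sublist of \<open>rev ts\<close>, graded by the number of edges.  For \<open>ts = inversions ws\<close> and \<open>x = wp ws\<close> it is,
  up to sign, the coefficient at \<open>T\<^sub>u\<close> of \<open>T\<^sub>x\<^sup>-\<^sup>1 T\<^sub>x\<^sub>z\<close> in the Hecke algebra.\<close>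

primrec chain_poly :: "'a list \<Rightarrow> 'a \<Rightarrow> 'a \<Rightarrow> nat poly" where
  "chain_poly [] z u = (if z = u then 1 else 0)"
| "chain_poly (t # ts) z u = chain_poly ts z u + (if N z t then pCons 0 (chain_poly ts (t \<otimes> z) u) else 0)"

primrec reduced :: "'a list \<Rightarrow> bool" where
  "reduced [] = True"
| "reduced (s # ws) = (s \<in> S \<and> reduced ws \<and> \<not> N (wp ws) s)"

text \<open>For a reduced word these are the left inversions of \<open>inv (wp ws)\<close>, in the
  order in which the letters produce them; for a reduced word of the longest element this is a
  reflection order.\<close>

primrec inversions :: "'a list \<Rightarrow> 'a list" where
  "inversions [] = []"
| "inversions (s # ws) = (inv (wp ws) \<otimes> s \<otimes> wp ws) # inversions ws"

lemma reduced_lists: "reduced ws \<Longrightarrow> ws \<in> lists S"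
  by (induction ws) auto

lemma inversions_R: "ws \<in> lists S \<Longrightarrow> set (inversions ws) \<subseteq> R"
  by (induction ws) auto

lemma conj_eq_iff:
  assumes "x \<in> carrier G" "t \<in> carrier G" "s \<in> carrier G"
  shows "x \<otimes> t \<otimes> inv x = s \<longleftrightarrow> t = inv x \<otimes> s \<otimes> x"
  using assms by (auto simp: m_assoc)

lemma N_inv_Cons:
  assumes "s \<in> S" "x \<in> carrier G" "t \<in> carrier G"
  shows "N (inv (s \<otimes> x)) t = (N (inv x) t \<noteq> (t = inv x \<otimes> s \<otimes> x))"
  using N_mult[of "inv x" s t] N_S[of s "x \<otimes> t \<otimes> inv x"] conj_eq_iff[of x t s] assms
  by (auto simp: inv_mult_group)

lemma N_inv_conj:
  assumes "x \<in> carrier G" "s \<in> carrier G"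
  shows "N (inv x) (inv x \<otimes> s \<otimes> x) = N x s"
  using N_inv[of x "inv x \<otimes> s \<otimes> x"] assms by (simp add: m_assoc)

text \<open>A new first letter toggles exactly one reflection (\<open>N_inv_Cons\<close>), and
  reducedness says that it was absent before.\<close>

lemma set_inversions:
  assumes "reduced ws" "t \<in> carrier G"
  shows "t \<in> set (inversions ws) \<longleftrightarrow> N (inv (wp ws)) t"
  using assms
proof (induction ws)
  case (Cons s ws)
  then show ?case
    using N_inv_Cons[of s "wp ws" t] N_inv_conj[of "wp ws" s] reduced_lists[of ws] by auto
qed simp

lemma distinct_inversions: "reduced ws \<Longrightarrow> distinct (inversions ws)"
proof (induction ws)
  case (Cons s ws)
  then show ?case
    using set_inversions[of ws "inv (wp ws) \<otimes> s \<otimes> wp ws"] N_inv_conj[of "wp ws" s] reduced_lists[of ws] by auto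
qed simp

lemma inversions_append: "\<exists>ts. inversions (as @ bs) = ts @ inversions bs"
  by (induction as) auto

lemma N_S_right:
  assumes "z \<in> carrier G" "s \<in> S" "t \<in> carrier G" "t \<otimes> z \<noteq> z \<otimes> s"
  shows "N (z \<otimes> s) t = N z t"
proof -
  have "inv z \<otimes> t \<otimes> z \<noteq> s"
    using assms by (auto simp: m_assoc)
  then show ?thesis
    using N_mult[of z s t] N_S[of s "inv z \<otimes> t \<otimes> z"] assms by auto
qed

text \<open>The right action of \<open>T\<^sub>s\<close> on \<open>T\<^sub>x\<^sup>-\<^sup>1 T\<^sub>x\<^sub>z\<close>; all terms are moved to the side where
  they are positive.\<close>

lemma chain_poly_right_action:
  assumes "reduced ws" "s \<in> S" "z \<in> carrier G" "u \<in> carrier G"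
  shows "chain_poly (inversions ws) z (u \<otimes> s) +
      (if N z (z \<otimes> s \<otimes> inv z) \<noteq> N (inv (wp ws)) (z \<otimes> s \<otimes> inv z)
       then pCons 0 (chain_poly (inversions ws) z u) else 0) =
    chain_poly (inversions ws) (z \<otimes> s) u + (if rdesc u s then pCons 0 (chain_poly (inversions ws) z u) else 0)"
  using assms
proof (induction ws arbitrary: z)
  case Nil
  have "z = u \<otimes> s \<longleftrightarrow> z \<otimes> s = u"
    using Nil by (auto simp: m_assoc)
  then show ?case
    using Nil by (auto simp: rdesc_def)
next
  case (Cons a ws)
  define x where "x = wp ws"
  \<comment> \<open>\<open>t\<close> is the label contributed by the new letter \<open>a\<close>;
    \<open>q\<close> is the label of the edge joining \<open>z\<close> and
    \<open>z \<otimes> s\<close>.\<close>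
  define t where "t = inv x \<otimes> a \<otimes> x"
  define q where "q = z \<otimes> s \<otimes> inv z"
  have x: "x \<in> carrier G" "a \<in> S" "\<not> N x a" "reduced ws"
    using Cons.prems reduced_lists[of ws] by (auto simp: x_def)
  have t: "t \<in> R" "\<not> N (inv x) t"
    using x N_inv_conj[of x a] by (simp_all add: t_def)
  have q: "q \<in> R" "q \<otimes> z = z \<otimes> s"
    using Cons.prems R_conj[of s z] by (simp_all only: q_def) (simp_all add: m_assoc)
  have z: "z \<in> carrier G" "s \<in> S" "u \<in> carrier G" using Cons.prems by auto
  have Nx': "N (inv (a \<otimes> x)) q = (N (inv x) q \<noteq> (q = t))"
    using N_inv_Cons[of a x q] x q by (simp add: t_def)
  have IH: "chain_poly (inversions ws) y (u \<otimes> s) +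
      (if N y (y \<otimes> s \<otimes> inv y) \<noteq> N (inv x) (y \<otimes> s \<otimes> inv y)
       then pCons 0 (chain_poly (inversions ws) y u) else 0) =
    chain_poly (inversions ws) (y \<otimes> s) u + (if rdesc u s then pCons 0 (chain_poly (inversions ws) y u) else 0)"
    if "y \<in> carrier G" for y
    using Cons.IH[of y] x z that unfolding x_def by simp
  note IHz = IH[OF z(1), folded q_def]
  define P where "P = (pCons 0 :: nat poly \<Rightarrow> nat poly)"
  have P_add: "P (f + g) = P f + P g" and P_0: "P 0 = 0" for f g
    by (simp_all add: P_def)
  have unfold: "inversions (a # ws) = t # inversions ws" "wp (a # ws) = a \<otimes> x"
    by (simp_all add: x_def t_def)
  show ?case
  proof (cases "q = t")
    \<comment> \<open>Here \<open>t\<close> exchanges \<open>z\<close> and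
      \<open>z \<otimes> s\<close>, so the claim combines the induction hypotheses at these two
      elements.\<close>
    case True
    have "t \<otimes> z = z \<otimes> s"
      using q(2) True by simp
    moreover from this have "t \<otimes> (z \<otimes> s) = z"
      using cancel_R[OF t(1) z(1)] by simp
    ultimately have tz: "t \<otimes> z = z \<otimes> s" "t \<otimes> (z \<otimes> s) = z" .
    have Nzs: "N (z \<otimes> s) t = (\<not> N z t)"
      using N_refl_mult[of t z] t z tz by simp
    have c: "z \<otimes> s \<otimes> s \<otimes> inv (z \<otimes> s) = t"
      using z True[symmetric] by (simp add: q_def group_norm)
    have zss: "z \<otimes> s \<otimes> s = z"
      using z by (simp add: m_assoc)
    have "chain_poly (inversions ws) (z \<otimes> s) (u \<otimes> s) +
        (if N (z \<otimes> s) t then P (chain_poly (inversions ws) (z \<otimes> s) u) else 0) =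
      chain_poly (inversions ws) z u + (if rdesc u s then P (chain_poly (inversions ws) (z \<otimes> s) u) else 0)"
      unfolding P_def using IH[of "z \<otimes> s", unfolded c, unfolded zss] z t(2)
      by (simp split del: if_split)
    from arg_cong2[OF IHz this, of "\<lambda>f g. f + P g"] show ?thesis
      using IHz t(2) Nx' Nzs
      unfolding unfold chain_poly.simps q_def[symmetric] P_def[symmetric] True
      by (cases "N z t"; cases "rdesc u s") (simp_all add: tz P_add P_0 ac_simps)
  next
    \<comment> \<open>Here \<open>t\<close> carries the edge at \<open>z\<close> to the edge joining
      \<open>t \<otimes> z\<close> and \<open>t \<otimes> z \<otimes> s\<close>. The condition of
      the hypothesis at \<open>t \<otimes> z\<close> agrees with that at \<open>z\<close>, because
      the same extra term \<open>N t (t \<otimes> q \<otimes> t)\<close> arises on both of its sides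
      and cancels.\<close>
    case False
    have tq: "t \<otimes> q \<otimes> t \<in> R"
      using R_conj[of q t] t q by simp
    have ne: "t \<otimes> z \<noteq> z \<otimes> s"
      using False q t z by (metis R_carrier r_cancel)
    have Nzs: "N (z \<otimes> s) t = N z t"
      using N_S_right ne z t by simp
    have ctz: "t \<otimes> z \<otimes> s \<otimes> inv (t \<otimes> z) = t \<otimes> q \<otimes> t"
      using z t by (simp add: q_def group_norm)
    have tqt: "t \<otimes> q \<otimes> t \<noteq> t"
    proof
      assume "t \<otimes> q \<otimes> t = t"
      then have "t \<otimes> (t \<otimes> q \<otimes> t) \<otimes> t = t \<otimes> t \<otimes> t" by simp
      then show False using False t q by (simp add: m_assoc)
    qed
    have "N (t \<otimes> inv x) (t \<otimes> q \<otimes> t) = (N t (t \<otimes> q \<otimes> t) \<noteq> N (inv x) q)"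
      using N_mult[of t "inv x" "t \<otimes> q \<otimes> t"] t q x by (simp add: m_assoc)
    moreover have "t \<otimes> inv x = inv (a \<otimes> x)"
      using x by (simp add: t_def group_norm)
    moreover have "N (inv (a \<otimes> x)) (t \<otimes> q \<otimes> t) = N (inv x) (t \<otimes> q \<otimes> t)"
      using N_inv_Cons[of a x "t \<otimes> q \<otimes> t"] x tq tqt by (auto simp: t_def)
    ultimately have 1: "N (inv x) (t \<otimes> q \<otimes> t) = (N t (t \<otimes> q \<otimes> t) \<noteq> N (inv x) q)"
      by simp
    have 2: "N (t \<otimes> z) (t \<otimes> q \<otimes> t) = (N t (t \<otimes> q \<otimes> t) \<noteq> N z q)"
      using N_mult[of t z "t \<otimes> q \<otimes> t"] t q z by (simp add: m_assoc)
    have desc: "(N (t \<otimes> z) (t \<otimes> q \<otimes> t) \<noteq> N (inv x) (t \<otimes> q \<otimes> t)) = (N z q \<noteq> N (inv x) q)"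
      using 1 2 by auto
    have assoc: "t \<otimes> z \<otimes> s = t \<otimes> (z \<otimes> s)"
      using z t by (simp add: m_assoc)
    have desc: "(N (t \<otimes> z) (t \<otimes> q \<otimes> t) \<noteq> N (inv x) (t \<otimes> q \<otimes> t)) = (N z q \<noteq> N (inv x) q)"
      using 1 2 by auto
    have assoc: "t \<otimes> z \<otimes> s = t \<otimes> (z \<otimes> s)"
      using z t by (simp add: m_assoc)
    have IHtz: "chain_poly (inversions ws) (t \<otimes> z) (u \<otimes> s) +
        (if N z q \<noteq> N (inv x) q then pCons 0 (chain_poly (inversions ws) (t \<otimes> z) u) else 0) =
      chain_poly (inversions ws) (t \<otimes> (z \<otimes> s)) u + (if rdesc u s then pCons 0 (chain_poly (inversions ws) (t \<otimes> z) u) else 0)"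
      using IH[of "t \<otimes> z", unfolded ctz desc, unfolded assoc] z t by (simp split del: if_split)
    show ?thesis
      using arg_cong2[OF IHz IHtz, of "\<lambda>f g. f + P g"] IHz False
      unfolding unfold chain_poly.simps q_def[symmetric] Nx' P_def[symmetric] Nzs
      by (cases "N z t"; cases "rdesc u s"; cases "N z q = N (inv x) q")
        (simp_all add: P_add P_0 ac_simps)
  qed
qed

lemma chain_poly_nonzero_ble:
  assumes "chain_poly ts z u \<noteq> 0" "z \<in> carrier G" "set ts \<subseteq> R"
  shows "ble u z"
  using assms
proof (induction ts arbitrary: z)
  case (Cons t ts)
  show ?case
  proof (cases "chain_poly ts z u = 0")
    case True
    then have "N z t" "chain_poly ts (t \<otimes> z) u \<noteq> 0"
      using Cons.prems by (auto split: if_splits)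
    then show ?thesis
      using Cons.IH[of "t \<otimes> z"] Cons.prems refl_ble(2)[of t z] ble_trans by auto
  qed (use Cons in auto)
qed (auto split: if_splits)

text \<open>A nonempty chain has a topmost edge, and \<open>t\<close> is its label; at a sink
  \<open>z\<close> such an edge leads to a contradiction.\<close>

lemma chain_poly_nonzero_last:
  assumes "chain_poly ts z u \<noteq> 0" "z \<in> carrier G" "set ts \<subseteq> R" "u \<noteq> z"
  shows "\<exists>t\<in>set ts. N z t \<and> ble u (t \<otimes> z)"
  using assms
proof (induction ts)
  case (Cons t ts)
  show ?case
  proof (cases "chain_poly ts z u = 0")
    case True
    then have "N z t" "chain_poly ts (t \<otimes> z) u \<noteq> 0"
      using Cons.prems by (auto split: if_splits)
    then show ?thesis
      using chain_poly_nonzero_ble[of ts "t \<otimes> z" u] Cons.prems by auto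
  qed (use Cons in auto)
qed (auto split: if_splits)

text \<open>Dually, \<open>t\<close> is the label of the lowest edge of a counted chain.\<close>

lemma chain_poly_nonzero_first:
  assumes "chain_poly ts z u \<noteq> 0" "z \<in> carrier G" "set ts \<subseteq> R" "u \<noteq> z"
  shows "\<exists>t\<in>set ts. \<not> N u t \<and> ble (t \<otimes> u) z"
  using assms
proof (induction ts arbitrary: z)
  case (Cons t ts)
  show ?case
  proof (cases "chain_poly ts z u = 0")
    case True
    then have *: "N z t" "chain_poly ts (t \<otimes> z) u \<noteq> 0"
      using Cons.prems by (auto split: if_splits)
    show ?thesis
    proof (cases "u = t \<otimes> z")
      case True
      then show ?thesis
        using * Cons.prems N_refl_mult[of t z] by auto
    next
      case False
      then show ?thesis
        using Cons.IH[of "t \<otimes> z"] * Cons.prems refl_ble(2)[of t z] ble_trans by fastforce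
    qed
  qed (use Cons in auto)
qed (auto split: if_splits)

lemma chain_poly_diag:
  assumes "z \<in> carrier G" "set ts \<subseteq> R"
  shows "chain_poly ts z z = 1"
  using assms(2)
proof (induction ts)
  case (Cons t ts)
  have "chain_poly ts (t \<otimes> z) z = 0" if "N z t"
  proof -
    have "len (t \<otimes> z) < len z"
      using N_len_less[of z t] that assms Cons.prems by simp
    then have "\<not> ble z (t \<otimes> z)"
      by (metis ble_len less_asym less_irrefl)
    then show ?thesis
      using chain_poly_nonzero_ble[of ts "t \<otimes> z" z] assms Cons.prems by auto
  qed
  then show ?case
    using Cons by auto
qed simp

text \<open>Each edge raises the length, which bounds the number of edges. Hence the coefficient at
  the length difference counts saturated chains.\<close>

lemma chain_poly_degree:
  assumes "z \<in> carrier G" "set ts \<subseteq> R" "len z < len u + k"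
  shows "Polynomial.coeff (chain_poly ts z u) k = 0"
  using assms
proof (induction ts arbitrary: z k)
  case (Cons t ts)
  have "Polynomial.coeff (pCons 0 (chain_poly ts (t \<otimes> z) u)) k = 0" if "N z t"
    using Cons.IH[of "t \<otimes> z" "k - 1"] Cons.prems that len_less_iff_N[of t z]
    by (cases k) auto
  then show ?case
    using Cons by auto
qed auto

text \<open>Going up, a chain uses its labels from \<open>bs\<close> before those from
  \<open>as\<close>; \<open>m\<close> is the vertex at which it changes over.\<close>

lemma chain_poly_append:
  assumes "finite (carrier G)" "v \<in> carrier G" "set (as @ bs) \<subseteq> R"
  shows "chain_poly (as @ bs) v u = (\<Sum>m\<in>carrier G. chain_poly as v m * chain_poly bs m u)"
  using assms(2,3)
proof (induction as arbitrary: v)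
  case Nil
  have "(\<Sum>m\<in>carrier G. chain_poly [] v m * chain_poly bs m u) = (\<Sum>m\<in>carrier G. if v = m then chain_poly bs m u else 0)"
    by (rule sum.cong) auto
  also have "\<dots> = chain_poly bs v u"
    using assms(1) Nil by simp
  finally show ?case by simp
next
  case (Cons t as)
  have "pCons 0 (\<Sum>m\<in>carrier G. chain_poly as (t \<otimes> v) m * chain_poly bs m u) =
      (\<Sum>m\<in>carrier G. pCons 0 (chain_poly as (t \<otimes> v) m) * chain_poly bs m u)"
    by (simp add: pCons_0_sum)
  then show ?case
    using Cons by (auto simp: algebra_simps sum.distrib)
qed

text \<open>Every Bruhat interval has exactly one saturated chain with increasing labels.\<close>

lemma chain_poly_top_coeff:
  assumes ws: "reduced ws" "\<And>s. s \<in> S \<Longrightarrow> N (wp ws) s"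
    and "u \<in> carrier G" "v \<in> carrier G" "len v = len u + k"
  shows "Polynomial.coeff (chain_poly (inversions ws) v u) k = (if ble u v then 1 else 0)"
  using assms(3-)
proof (induction "len v" arbitrary: u v k)
  case 0
  then show ?case
    using len_0_iff[of u] len_0_iff[of v] chain_poly_diag[of \<one> "inversions ws"] inversions_R reduced_lists ws by simp
next
  case (Suc n)
  have invR: "set (inversions ws) \<subseteq> R"
    using inversions_R reduced_lists ws by blast
  obtain s where s: "s \<in> S" "rdesc v s"
    using ex_rdesc[of v] Suc.hyps(2) Suc.prems(2) by (metis len_one nat.distinct(1))
  have vs: "len v = Suc (len (v \<otimes> s))" "\<not> rdesc (v \<otimes> s) s" "v \<otimes> s \<in> carrier G"
    using len_rdesc(2)[of s v] rdesc_mult_S[of s v] s Suc.prems by auto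
  \<comment> \<open>\<open>chain_poly_right_action\<close> is applied at
    \<open>v \<otimes> s\<close>. Its left correction term is present, since every reflection is an
    inversion of the inverse of the longest element; \<open>rec\<close> is then the recursion for
    the R-polynomials.\<close>
  have "\<not> N (v \<otimes> s) (v \<otimes> s \<otimes> s \<otimes> inv (v \<otimes> s))"
    using vs(2) by (simp add: rdesc_def)
  moreover have "N (inv (wp ws)) (v \<otimes> s \<otimes> s \<otimes> inv (v \<otimes> s))"
    using N_maximal(2)[OF wp_carrier[OF reduced_lists[OF ws(1)]] ws(2) R_conj[OF S_R[OF s(1)] vs(3)]]
    by blast
  ultimately have rec: "chain_poly (inversions ws) (v \<otimes> s) (u \<otimes> s) + pCons 0 (chain_poly (inversions ws) (v \<otimes> s) u) =
      chain_poly (inversions ws) v u + (if rdesc u s then pCons 0 (chain_poly (inversions ws) (v \<otimes> s) u) else 0)"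
    using chain_poly_right_action[OF ws(1) s(1) vs(3) Suc.prems(1)] s(1) Suc.prems by (simp add: m_assoc)
  show ?case
  proof (cases "rdesc u s")
    case True
    then have us: "len u = Suc (len (u \<otimes> s))" "\<not> rdesc (u \<otimes> s) s"
      using len_rdesc(2)[of s u] rdesc_mult_S[of s u] s Suc.prems by auto
    have "ble u v" if "ble (u \<otimes> s) (v \<otimes> s)"
      using lifting_above[of "u \<otimes> s" v s] ble_trans[OF that S_ble(2)] s Suc.prems
      by (simp add: m_assoc)
    then have "ble (u \<otimes> s) (v \<otimes> s) = ble u v"
      using lifting[of u v s] True s by metis
    moreover have "chain_poly (inversions ws) v u = chain_poly (inversions ws) (v \<otimes> s) (u \<otimes> s)"
      using rec True by simp
    ultimately show ?thesis
      using Suc.hyps(1)[of "v \<otimes> s" "u \<otimes> s" k] Suc.hyps(2) Suc.prems vs us s by simp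
  next
    case False
    then have us: "len (u \<otimes> s) = Suc (len u)"
      using len_rdesc(1)[of s u] s Suc.prems by auto
    \<comment> \<open>The length difference has dropped by two, so this summand has no term of
      degree \<open>k\<close>.\<close>
    have "Polynomial.coeff (chain_poly (inversions ws) (v \<otimes> s) (u \<otimes> s)) k = 0"
      using chain_poly_degree[of "v \<otimes> s" "inversions ws" "u \<otimes> s" k] invR vs us Suc.prems by auto
    moreover have "chain_poly (inversions ws) v u = chain_poly (inversions ws) (v \<otimes> s) (u \<otimes> s) + pCons 0 (chain_poly (inversions ws) (v \<otimes> s) u)"
      using rec False by simp
    ultimately have c: "Polynomial.coeff (chain_poly (inversions ws) v u) k =
        Polynomial.coeff (pCons 0 (chain_poly (inversions ws) (v \<otimes> s) u)) k"
      by (simp only: Polynomial.coeff_add add_0)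
    show ?thesis
    proof (cases k)
      case 0
      \<comment> \<open>Equal lengths would force \<open>u = v\<close>, but \<open>s\<close> is a
        descent of \<open>v\<close> and not of \<open>u\<close>.\<close>
      then have "\<not> ble u v"
        using ble_len[of u v] False s Suc.prems by auto
      then show ?thesis using c 0 by simp
    next
      case (Suc j)
      have "ble u v" if "ble u (v \<otimes> s)"
        using ble_trans[OF that S_ble(2)] s Suc.prems by simp
      then have "ble u (v \<otimes> s) = ble u v"
        using lifting_below[of u v s] False s by metis
      then show ?thesis
        using Suc.hyps(1)[of "v \<otimes> s" u j] Suc.hyps(2) Suc.prems c Suc vs by simp
    qed
  qed
qed

section \<open>Reduced words and the longest element\<close>

lemma ex_reduced: "w \<in> carrier G \<Longrightarrow> \<exists>ws. reduced ws \<and> wp ws = w"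
proof (induction "len w" arbitrary: w rule: less_induct)
  case less
  show ?case
  proof (cases "w = \<one>")
    case True
    then show ?thesis by (intro exI[of _ "[]"]) simp
  next
    case False
    obtain vs where vs: "vs \<in> lists S" "length vs = len w" "wp vs = w"
      using reduced_word less.prems by blast
    then obtain s us where us: "vs = s # us"
      using False by (cases vs) auto
    have s: "s \<in> S" "us \<in> lists S" "s \<otimes> w = wp us"
      using vs us by auto
    then have "len (s \<otimes> w) < len w"
      using len_le[of us] vs us by simp
    then obtain ws where "reduced ws" "wp ws = s \<otimes> w"
      using less.hyps[of "s \<otimes> w"] less.prems s(1) by auto
    moreover have "\<not> N (s \<otimes> w) s"
      using N_refl_mult[of s w] len_less_iff_N(1)[of s w] \<open>len (s \<otimes> w) < len w\<close> less.prems s(1)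
      by simp
    ultimately show ?thesis
      using less.prems s(1) by (intro exI[of _ "s # ws"]) simp
  qed
qed

text \<open>Letters that are not yet left descents are prefixed; distinctness of the inversions
  bounds the length in a finite group. So the inversions of a reduced word form a final segment of a
  reflection order.\<close>

lemma reduced_extend:
  assumes "finite (carrier G)" "reduced ws"
  shows "\<exists>as. reduced (as @ ws) \<and> (\<forall>s\<in>S. N (wp (as @ ws)) s)"
  using assms(2)
proof (induction "card (carrier G) - length ws" arbitrary: ws rule: less_induct)
  case less
  show ?case
  proof (cases "\<forall>s\<in>S. N (wp ws) s")
    case True
    then show ?thesis
      using less.prems by (intro exI[of _ "[]"]) simp
  next
    case False
    then obtain s where s: "s \<in> S" "reduced (s # ws)"
      using less.prems by auto
    have "length (inversions vs) = length vs" for vs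
      by (induction vs) auto
    then have "length (s # ws) = card (set (inversions (s # ws)))"
      using distinct_card[OF distinct_inversions[OF s(2)]] by metis
    also have "\<dots> \<le> card (carrier G)"
      using inversions_R[OF reduced_lists[OF s(2)]] by (intro card_mono assms(1)) auto
    finally have "card (carrier G) - length (s # ws) < card (carrier G) - length ws"
      by simp
    then obtain as where "reduced (as @ s # ws)" "\<forall>t\<in>S. N (wp (as @ s # ws)) t"
      using less.hyps s(2) by blast
    then show ?thesis
      by (intro exI[of _ "as @ [s]"]) simp
  qed
qed

section \<open>Existence and uniqueness of sinks\<close>

text \<open>A local maximum of \<open>z \<mapsto> x z\<close> on \<open>[u, v]\<close>: the condition \<open>N z t \<noteq> N (inv x) t\<close> says that
  \<open>x t z\<close> is shorter than \<open>x z\<close>.\<close>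

definition sink :: "'a \<Rightarrow> 'a \<Rightarrow> 'a \<Rightarrow> 'a \<Rightarrow> bool" where
  "sink x u v z \<longleftrightarrow> ble u z \<and> ble z v \<and>
    (\<forall>t\<in>R. ble u (t \<otimes> z) \<longrightarrow> ble (t \<otimes> z) v \<longrightarrow> N z t \<noteq> N (inv x) t)"

lemma sink_unique:
  assumes fin: "finite (carrier G)" and x: "x \<in> carrier G"
    and uv: "ble u v" and z: "sink x u v z1" "sink x u v z2"
  shows "z1 = z2"
proof -
  obtain as0 where as0: "reduced as0" "\<And>s. s \<in> S \<Longrightarrow> N (wp as0) s"
    using reduced_extend[OF fin, of "[]"] by auto
  define w0 where "w0 = wp as0"
  have w0: "w0 \<in> carrier G" "\<And>t. t \<in> R \<Longrightarrow> N (inv w0) t"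
    using N_maximal(2)[of w0] as0 reduced_lists by (auto simp: w0_def)
  \<comment> \<open>Multiplying by the longest element \<open>w0\<close> complements the inversion
    set: \<open>inversions ws\<close> lists the reflections that are not inversions of
    \<open>inv x\<close>, and \<open>ts\<close> the others. Going up, the former come first.\<close>
  obtain ws where ws: "reduced ws" "wp ws = w0 \<otimes> x"
    using ex_reduced w0 x by blast
  obtain as where as: "reduced (as @ ws)" "\<And>s. s \<in> S \<Longrightarrow> N (wp (as @ ws)) s"
    using reduced_extend[OF fin ws(1)] by blast
  obtain ts where ts: "inversions (as @ ws) = ts @ inversions ws"
    using inversions_append by blast
  have tsR: "set (ts @ inversions ws) \<subseteq> R"
    using inversions_R[OF reduced_lists[OF as(1)]] ts by simp
  have inversions_iff: "t \<in> set (inversions ws) \<longleftrightarrow> \<not> N (inv x) t" if "t \<in> R" for t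
    using set_inversions[OF ws(1), of t] N_mult[of "inv x" "inv w0" t] w0(2)[OF R_conj[OF that x]]
      that x w0(1) ws(2) by (simp add: inv_mult_group)
  have ts_N: "N (inv x) t" if "t \<in> set ts" for t
    using inversions_iff[of t] distinct_inversions[OF as(1)] ts tsR that by auto
  \<comment> \<open>The unique increasing saturated chain from \<open>a\<close> to \<open>b\<close>,
    counted by the vertex \<open>m\<close> where its labels pass from \<open>inversions ws\<close>
    to \<open>ts\<close>.\<close>
  have top: "Polynomial.coeff (\<Sum>m\<in>carrier G. chain_poly ts b m * chain_poly (inversions ws) m a) (len b - len a) = 1"
    if "ble a b" for a b
  proof -
    have "len b = len a + (len b - len a)"
      using ble_len[OF that] by auto
    then show ?thesis
      using chain_poly_top_coeff[OF as, of a b "len b - len a"] that ble_carrier[OF that]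
        chain_poly_append[OF fin _ tsR, of b a] ts by simp
  qed
  have sum_single: "(\<Sum>m\<in>carrier G. f m) = f c"
    if "c \<in> carrier G" "\<And>m. m \<noteq> c \<Longrightarrow> m \<in> carrier G \<Longrightarrow> f m = 0" for f :: "'a \<Rightarrow> nat poly" and c
    using that fin sum.remove[OF fin that(1), of f] by simp
  have coeff_sink: "Polynomial.coeff (chain_poly ts v z * chain_poly (inversions ws) z u) (len v - len u) \<ge> 1"
    and z_carrier: "z \<in> carrier G" if "sink x u v z" for z
  proof -
    have uz: "ble u z" and zv: "ble z v"
      and snk: "\<And>t. t \<in> R \<Longrightarrow> ble u (t \<otimes> z) \<Longrightarrow> ble (t \<otimes> z) v \<Longrightarrow> N z t \<noteq> N (inv x) t"
      using that by (auto simp: sink_def)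
    show zc: "z \<in> carrier G" using ble_carrier[OF uz] by simp
    have vc: "v \<in> carrier G" using ble_carrier[OF zv] by simp
    \<comment> \<open>Otherwise the last edge into \<open>z\<close> has a label in
      \<open>ts\<close>, which the sink condition forbids. So the chain from \<open>u\<close> to
      \<open>z\<close> has all its labels in \<open>inversions ws\<close>.\<close>
    have "chain_poly ts z m * chain_poly (inversions ws) m u = 0" if m: "m \<noteq> z" "m \<in> carrier G" for m
    proof (rule ccontr)
      assume "chain_poly ts z m * chain_poly (inversions ws) m u \<noteq> 0"
      then have nz: "chain_poly ts z m \<noteq> 0" "chain_poly (inversions ws) m u \<noteq> 0" by auto
      obtain t where t: "t \<in> set ts" "N z t" "ble m (t \<otimes> z)"
        using chain_poly_nonzero_last[OF nz(1) zc _ m(1)] tsR by auto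
      have "ble u m"
        using chain_poly_nonzero_ble[OF nz(2) m(2)] tsR by simp
      moreover have tR: "t \<in> R"
        using t(1) tsR by auto
      ultimately have "ble u (t \<otimes> z)" "ble (t \<otimes> z) v"
        using ble_trans t(3) refl_ble(2)[OF tR zc t(2)] zv by blast+
      then show False
        using snk[OF tR] ts_N[OF t(1)] t(2) by simp
    qed
    then have low: "Polynomial.coeff (chain_poly (inversions ws) z u) (len z - len u) = 1"
      using top[OF uz] sum_single[OF zc, of "\<lambda>m. chain_poly ts z m * chain_poly (inversions ws) m u"] chain_poly_diag[OF zc] tsR by simp
    \<comment> \<open>Dually, the first edge out of \<open>z\<close> cannot have a label in
      \<open>inversions ws\<close>.\<close>
    have "chain_poly ts v m * chain_poly (inversions ws) m z = 0" if m: "m \<noteq> z" "m \<in> carrier G" for m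
    proof (rule ccontr)
      assume "chain_poly ts v m * chain_poly (inversions ws) m z \<noteq> 0"
      then have nz: "chain_poly ts v m \<noteq> 0" "chain_poly (inversions ws) m z \<noteq> 0" by auto
      obtain t where t: "t \<in> set (inversions ws)" "\<not> N z t" "ble (t \<otimes> z) m"
        using chain_poly_nonzero_first[OF nz(2) m(2) _ m(1)[symmetric]] tsR by auto
      have "ble m v"
        using chain_poly_nonzero_ble[OF nz(1) vc] tsR by simp
      moreover have tR: "t \<in> R"
        using t(1) tsR by auto
      ultimately have "ble u (t \<otimes> z)" "ble (t \<otimes> z) v"
        using ble_trans t(3) refl_ble(1)[OF tR zc t(2)] uz by blast+
      then show False
        using snk[OF tR] inversions_iff[OF tR] t(1,2) by simp
    qed
    then have up: "Polynomial.coeff (chain_poly ts v z) (len v - len z) = 1"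
      using top[OF zv] sum_single[OF zc, of "\<lambda>m. chain_poly ts v m * chain_poly (inversions ws) m z"] chain_poly_diag[OF zc] tsR by simp
    have le: "len u \<le> len z" "len z \<le> len v"
      using ble_len[OF uz] ble_len[OF zv] by auto
    \<comment> \<open>The summands of the Cauchy product are natural numbers, so nothing cancels,
      and the one at \<open>len v - len z\<close> is the product of the coefficients in
      \<open>up\<close> and \<open>low\<close>.\<close>
    define f where "f i = Polynomial.coeff (chain_poly ts v z) i *
      Polynomial.coeff (chain_poly (inversions ws) z u) (len v - len u - i)" for i
    have "f (len v - len z) = 1"
      using low up le by (simp add: f_def)
    moreover have "f (len v - len z) \<le> sum f {..len v - len u}"
      using le by (intro member_le_sum) auto
    ultimately show "Polynomial.coeff (chain_poly ts v z * chain_poly (inversions ws) z u) (len v - len u) \<ge> 1"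
      by (simp add: Polynomial.coeff_mult f_def)
  qed
  \<comment> \<open>\<open>g m\<close> counts the increasing saturated chains from \<open>u\<close>
    to \<open>v\<close> that change over at \<open>m\<close>. The total is 1, and each sink accounts
    for at least 1.\<close>
  define g where "g m = Polynomial.coeff (chain_poly ts v m * chain_poly (inversions ws) m u) (len v - len u)" for m
  have "sum g (carrier G) = 1"
    using top[OF uv] by (simp add: g_def Polynomial.coeff_sum)
  moreover have "sum g {z1, z2} \<le> sum g (carrier G)"
    using fin z_carrier[OF z(1)] z_carrier[OF z(2)] by (intro sum_mono2) auto
  ultimately show ?thesis
    using coeff_sink[OF z(1)] coeff_sink[OF z(2)] by (cases "z1 = z2") (auto simp: g_def)
qed

text \<open>As long as \<open>z\<close> is not a sink, some \<open>t \<otimes> z\<close> in the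
  interval makes \<open>x \<otimes> z\<close> longer; lengths are bounded in a finite group.\<close>

lemma ble_sink:
  assumes fin: "finite (carrier G)" and x: "x \<in> carrier G" and "ble u z" "ble z v"
  shows "\<exists>m. sink x u v m \<and> ble (x \<otimes> z) (x \<otimes> m)"
  using assms(3,4)
proof (induction "Max (len ` carrier G) - len (x \<otimes> z)" arbitrary: z rule: less_induct)
  case less
  have z: "z \<in> carrier G" using ble_carrier less.prems by blast
  show ?case
  proof (cases "sink x u v z")
    case True
    then show ?thesis using x z by (intro exI[of _ z]) simp
  next
    case False
    then obtain t where t: "t \<in> R" "ble u (t \<otimes> z)" "ble (t \<otimes> z) v" "N z t = N (inv x) t"
      using less.prems by (auto simp: sink_def)
    \<comment> \<open>\<open>r\<close> is the label of the edge from \<open>x \<otimes> z\<close> to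
      \<open>x \<otimes> (t \<otimes> z)\<close>.\<close>
    define r where "r = x \<otimes> t \<otimes> inv x"
    have r: "r \<in> R" "r \<otimes> (x \<otimes> z) = x \<otimes> (t \<otimes> z)"
      using R_conj[OF t(1) x] t(1) x z by (simp_all only: r_def) (simp_all add: m_assoc)
    have "inv x \<otimes> r \<otimes> x = t"
      using t(1) x by (simp add: r_def m_assoc)
    moreover have "N x r = N (inv x) t"
      using N_inv[of x t] t(1) x by (simp add: r_def)
    ultimately have nN: "\<not> N (x \<otimes> z) r"
      using N_mult[of x z r] r(1) t(4) x z by simp
    then have "len (x \<otimes> z) < len (x \<otimes> (t \<otimes> z))"
      using len_less_iff_N(2)[of r "x \<otimes> z"] r x z by simp
    moreover have "len (x \<otimes> (t \<otimes> z)) \<le> Max (len ` carrier G)"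
      using fin x z t(1) by (intro Max_ge) auto
    ultimately have "Max (len ` carrier G) - len (x \<otimes> (t \<otimes> z)) < Max (len ` carrier G) - len (x \<otimes> z)"
      by simp
    then obtain m where "sink x u v m" "ble (x \<otimes> (t \<otimes> z)) (x \<otimes> m)"
      using less.hyps t by blast
    moreover have "ble (x \<otimes> z) (x \<otimes> (t \<otimes> z))"
      using refl_ble(1)[of r "x \<otimes> z"] nN r x z by simp
    ultimately show ?thesis
      using ble_trans by blast
  qed
qed

text \<open>Climbing from \<open>u\<close> yields a sink, and by uniqueness every climb ends at that
  same sink.\<close>

lemma interval_has_max:
  assumes "finite (carrier G)" "x \<in> carrier G" "ble u v"
  shows "\<exists>m. ble u m \<and> ble m v \<and> (\<forall>z. ble u z \<longrightarrow> ble z v \<longrightarrow> ble (x \<otimes> z) (x \<otimes> m))"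
proof -
  obtain m where m: "sink x u v m"
    using ble_sink[OF assms(1,2), of u u v] assms(3) ble_carrier by auto
  then have "ble (x \<otimes> z) (x \<otimes> m)" if "ble u z" "ble z v" for z
    using ble_sink[OF assms(1,2) that] sink_unique[OF assms] by blast
  then show ?thesis
    using m by (auto simp: sink_def)
qed

section \<open>From elements to cosets of the trivial subgroup\<close>

lemma coset_trivial: "z \<in> carrier G \<Longrightarrow> z <# parabolic G {} = {z}"
  by (simp add: parabolic_def generate_empty l_coset_def)

end

theorem theorem4p4:
  fixes G :: "('a, 'b) monoid_scheme" and S :: "'a set" and u v :: 'a
  assumes "coxeter_system G S"
    and "finite (carrier G)"
    and "u \<in> carrier G" and "v \<in> carrier G"
    and "bruhat_le G S u v"
  shows "coxeter_matroid G S {}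
           ((\<lambda>z. z <#\<^bsub>G\<^esub> parabolic G {}) `
              {z \<in> carrier G. bruhat_le G S u z \<and> bruhat_le G S z v})"
proof -
  interpret coxeter G S
    using assms(1) by (intro coxeter.intro coxeter_axioms.intro) (auto simp: coxeter_system_def)
  define I where "I = {z \<in> carrier G. ble u z \<and> ble z v}"
  have img: "(\<lambda>z. z <#\<^bsub>G\<^esub> parabolic G {}) ` I = (\<lambda>z. {z}) ` I"
    by (rule image_cong) (auto simp: I_def coset_trivial)
  have "\<exists>!A. A \<in> (\<lambda>z. {z}) ` I \<and> (\<forall>B\<in>(\<lambda>z. {z}) ` I. coset_wbruhat_le G S w B A)"
    if w: "w \<in> carrier G" for w
  proof -
    \<comment> \<open>The greatest element is taken for translation by the inverse of
      \<open>w\<close>; antisymmetry of the Bruhat order then makes it unique.\<close>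
    obtain m where "ble u m" "ble m v"
      and max: "\<And>z. ble u z \<Longrightarrow> ble z v \<Longrightarrow> wbruhat_le G S w z m"
      using interval_has_max[OF assms(2) inv_closed[OF w] assms(5)]
      unfolding wbruhat_le_def by blast
    then have m: "m \<in> I" "\<And>z. z \<in> I \<Longrightarrow> wbruhat_le G S w z m"
      using ble_carrier(2)[of u m] by (auto simp: I_def)
    have "n = m" if "n \<in> I" "wbruhat_le G S w m n" for n
    proof -
      have "inv\<^bsub>G\<^esub> w \<otimes>\<^bsub>G\<^esub> n = inv\<^bsub>G\<^esub> w \<otimes>\<^bsub>G\<^esub> m"
        using ble_antisym m(2)[OF that(1)] that(2) by (simp add: wbruhat_le_def)
      then show ?thesis
        using w m(1) that(1) by (simp add: I_def)
    qed
    then show ?thesis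
      using m by (intro ex1I[of _ "{m}"]) (auto simp: coset_wbruhat_le_def)
  qed
  moreover have "u \<in> I"
    using assms by (simp add: I_def)
  ultimately show ?thesis
    unfolding coxeter_matroid_def I_def[symmetric] img using img
    by (auto simp: I_def coset_trivial)
qed

end
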